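(* Let $c = c_1 + c_2 \mathbf{i_2} \in \mathbb{BC}$ with $c_1,c_2\in\mathbb{C}(\mathbf{i_1})$, and let $P_c(w)=w^2+c$ for $w\in\mathbb{BC}$. Let $w_1\in\mathbb{BC}$ be a fixed point of $P_c$ such that $w_1 \in \mathcal{J}_{c_1 - c_2 \mathbf{i_1}} \times_e \mathcal{J}_{c_1 + c_2 \mathbf{i_1}}$. Then the set $\bigcup_{k=1}^{\infty} P_c^{-k}(w_1)$ is dense in $\mathcal{J}_{c_1 - c_2 \mathbf{i_1}} \times_e \mathcal{J}_{c_1 + c_2 \mathbf{i_1}}$.
   Context: The bicomplex numbers are $\mathbb{BC}=\{z_1+z_2\mathbf{i_2} \mid z_1,z_2\in\mathbb{C}(\mathbf{i_1})\}$, where $\mathbb{C}(\mathbf{i_1})=\{x+y\mathbf{i_1}\mid x,y\in\mathbb{R}\}$ is the field of complex numbers with imaginary unit $\mathbf{i_1}$; $\mathbf{i_1}^2=\mathbf{i_2}^2=-1$, $\mathbf{i_1}\mathbf{i_2}=\mathbf{i_2}\mathbf{i_1}=\mathbf{j}$, $\mathbf{j}^2=1$. This is a commutative unitary ring, with norm $\|z_1+z_2\mathbf{i_2}\|=\sqrt{|z_1|^2+|z_2|^2}$ and the corresponding (Euclidean) topology. Put $\mathbf{e_1}=\frac{1+\mathbf{j}}{2}$, $\mathbf{e_2}=\frac{1-\mathbf{j}}{2}$; every bicomplex number is uniquely written $z_1+z_2\mathbf{i_2}=(z_1-z_2\mathbf{i_1})\mathbf{e_1}+(z_1+z_2\mathbf{i_1})\mathbf{e_2}$,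 and addition and multiplication are componentwise in this representation. For nonempty $X_1,X_2\subseteq\mathbb{C}(\mathbf{i_1})$, $X_1\times_e X_2:=\{w_1\mathbf{e_1}+w_2\mathbf{e_2}\mid w_1\in X_1,\ w_2\in X_2\}\subseteq\mathbb{BC}$. For $a\in\mathbb{C}(\mathbf{i_1})$ and $P_a(z)=z^2+a$ on $\mathbb{C}(\mathbf{i_1})$, with $P_a^n$ denoting the $n$-th iterate ($P_a^0(z)=z$), the filled-in Julia set is $\mathcal{K}_a=\{z\in\mathbb{C}(\mathbf{i_1})\mid \{P_a^n(z)\}_{n=0}^\infty \text{ is bounded}\}$ and the Julia set is its boundary $\mathcal{J}_a=\partial\mathcal{K}_a$. For $k\ge 1$, $P_c^{k}$ is the $k$-th iterate of $P_c$ on $\mathbb{BC}$ and $P_c^{-k}(w)=\{v\in\mathbb{BC}\mid P_c^k(v)=w\}$. *)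

theory Defs
  imports "HOL-Analysis.Analysis"
begin

text \<open>
  Bicomplex numbers: \<open>BC z1 z2\<close> stands for \<open>z1 + z2 i2\<close>, where the type \<^typ>\<open>complex\<close>,
  with its unit \<open>\<i>\<close>, plays the role of the field \<open>C(i1)\<close>.
\<close>

datatype bicomplex = BC (bc1: complex) (bc2: complex)

lemma bicomplex_eq_iff: "v = w \<longleftrightarrow> bc1 v = bc1 w \<and> bc2 v = bc2 w"
  by (cases v; cases w) simp

instantiation bicomplex :: comm_ring_1
begin

definition zero_bicomplex where "0 = BC 0 0"
definition one_bicomplex where "1 = BC 1 0"
definition plus_bicomplex where "v + w = BC (bc1 v + bc1 w) (bc2 v + bc2 w)"
definition uminus_bicomplex where "- v = BC (- bc1 v) (- bc2 v)"
definition minus_bicomplex where "v - w = BC (bc1 v - bc1 w) (bc2 v - bc2 w)"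
definition times_bicomplex where
  "v * w = BC (bc1 v * bc1 w - bc2 v * bc2 w) (bc1 v * bc2 w + bc2 v * bc1 w)"

instance
  by standard
    (simp_all add: zero_bicomplex_def one_bicomplex_def plus_bicomplex_def
      uminus_bicomplex_def minus_bicomplex_def times_bicomplex_def algebra_simps)

end

instantiation bicomplex :: real_algebra_1
begin

definition scaleR_bicomplex where "r *\<^sub>R v = BC (r *\<^sub>R bc1 v) (r *\<^sub>R bc2 v)"

instance
  by standard
    (simp_all add: plus_bicomplex_def times_bicomplex_def scaleR_bicomplex_def
      algebra_simps)

end

text \<open>
  The Euclidean norm is not submultiplicative on bicomplex numbers, so there is no instance of
  \<^class>\<open>real_normed_algebra\<close>.
\<close>

instantiation bicomplex :: real_normed_vector
begin

definition norm_bicomplex :: "bicomplex \<Rightarrow> real" where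
  "norm_bicomplex v = sqrt ((cmod (bc1 v))\<^sup>2 + (cmod (bc2 v))\<^sup>2)"

definition sgn_bicomplex :: "bicomplex \<Rightarrow> bicomplex" where
  "sgn_bicomplex v = v /\<^sub>R norm v"

definition dist_bicomplex :: "bicomplex \<Rightarrow> bicomplex \<Rightarrow> real" where
  "dist_bicomplex v w = norm (v - w)"

definition uniformity_bicomplex :: "(bicomplex \<times> bicomplex) filter" where
  "uniformity_bicomplex = (INF e\<in>{0 <..}. principal {(v, w). dist v w < e})"

definition open_bicomplex :: "bicomplex set \<Rightarrow> bool" where
  "open_bicomplex U \<longleftrightarrow>
    (\<forall>v\<in>U. eventually (\<lambda>(v', w). v' = v \<longrightarrow> w \<in> U) uniformity)"

lemma norm_bicomplex_eq_norm_Pair: "norm v = norm (bc1 v, bc2 v)"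
  by (simp add: norm_bicomplex_def norm_Pair)

instance
proof
  fix r :: real and v w :: bicomplex
  show "(norm v = 0) = (v = 0)"
    by (simp add: norm_bicomplex_eq_norm_Pair zero_bicomplex_def bicomplex_eq_iff zero_prod_def)
  show "norm (v + w) \<le> norm v + norm w"
    using norm_triangle_ineq[of "(bc1 v, bc2 v)" "(bc1 w, bc2 w)"]
    by (simp add: norm_bicomplex_eq_norm_Pair plus_bicomplex_def)
  show "norm (r *\<^sub>R v) = \<bar>r\<bar> * norm v"
    using norm_scaleR[of r "(bc1 v, bc2 v)"]
    by (simp add: norm_bicomplex_eq_norm_Pair scaleR_bicomplex_def)
qed (rule sgn_bicomplex_def dist_bicomplex_def open_bicomplex_def uniformity_bicomplex_def)+

end

definition bc_of_complex :: "complex \<Rightarrow> bicomplex" where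
  "bc_of_complex z = BC z 0"

definition bc_i1 :: bicomplex where "bc_i1 = bc_of_complex \<i>"
definition bc_i2 :: bicomplex where "bc_i2 = BC 0 1"
definition bc_j :: bicomplex where "bc_j = bc_i1 * bc_i2"

definition bc_e1 :: bicomplex where "bc_e1 = (1/2) *\<^sub>R (1 + bc_j)"
definition bc_e2 :: bicomplex where "bc_e2 = (1/2) *\<^sub>R (1 - bc_j)"

definition idem_prod :: "complex set \<Rightarrow> complex set \<Rightarrow> bicomplex set" (infixr \<open>\<times>\<^sub>e\<close> 80) where
  "X1 \<times>\<^sub>e X2 =
    {bc_of_complex w1 * bc_e1 + bc_of_complex w2 * bc_e2 | w1 w2. w1 \<in> X1 \<and> w2 \<in> X2}"

lemma BC_eq: "BC z1 z2 = bc_of_complex z1 + bc_of_complex z2 * bc_i2"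
  by (simp add: bc_of_complex_def bc_i2_def plus_bicomplex_def times_bicomplex_def)

lemma bc_units: "bc_i1\<^sup>2 = -1" "bc_i2\<^sup>2 = -1" "bc_j\<^sup>2 = 1"
  by (simp_all add: bc_i1_def bc_i2_def bc_j_def bc_of_complex_def power2_eq_square
      one_bicomplex_def times_bicomplex_def uminus_bicomplex_def)

lemma bc_idempotent_representation:
  "bc_of_complex z1 + bc_of_complex z2 * bc_i2 =
    bc_of_complex (z1 - z2 * \<i>) * bc_e1 + bc_of_complex (z1 + z2 * \<i>) * bc_e2"
  by (simp add: bc_of_complex_def bc_e1_def bc_e2_def bc_j_def bc_i1_def bc_i2_def
      one_bicomplex_def plus_bicomplex_def minus_bicomplex_def times_bicomplex_def
      scaleR_bicomplex_def scaleR_conv_of_real field_simps)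

text \<open>Used both over the complex and over the bicomplex numbers.\<close>

definition quad_poly :: "'a::comm_ring_1 \<Rightarrow> 'a \<Rightarrow> 'a" where
  "quad_poly a z = z\<^sup>2 + a"

definition filled_julia :: "complex \<Rightarrow> complex set" where
  "filled_julia a = {z. bounded (range (\<lambda>n. (quad_poly a ^^ n) z))}"

definition julia :: "complex \<Rightarrow> complex set" where
  "julia a = frontier (filled_julia a)"

definition dense_in :: "'a::topological_space set \<Rightarrow> 'a set \<Rightarrow> bool" where
  "dense_in S X \<longleftrightarrow> S \<subseteq> X \<and> X \<subseteq> closure S"

end

theory Submission
  imports Defs "HOL-Complex_Analysis.Great_Picard"
begin

text \<open>
  The idempotent components turn \<open>P\<^sub>c\<close> into a product of two complex quadratic
  maps, and the preimage sets of a fixed point increase with \<open>k\<close>, so the claim reduces to density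
  of the backward orbit of a fixed point \<open>u \<in> J\<^sub>a\<close> in \<open>J\<^sub>a\<close>.  If a disc around a
  point of \<open>J\<^sub>a\<close> missed this backward orbit, the iterates would omit there the two values \<open>u\<close>
  and \<open>- u\<close>, the two preimages of \<open>u\<close>, which are distinct because \<open>0 \<notin> J\<^sub>0\<close>.
  A nearby point of \<open>K\<^sub>a\<close> has bounded orbit, and
  Schottky's theorem transports that bound to a whole disc around it, which then lies in \<open>K\<^sub>a\<close>:
  a contradiction.
\<close>

section \<open>Complex quadratic maps\<close>

lemma funpow_fixpoint:
  assumes "f x = x"
  shows "(f ^^ n) x = x"
  using assms by (induction n) simp_all

lemma holomorphic_on_quad_poly_funpow: "(quad_poly a ^^ n) holomorphic_on S"
proof (induction n)
  case 0
  then show ?case by (simp add: id_def)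
next
  case (Suc n)
  have "quad_poly a ^^ Suc n = (\<lambda>z. ((quad_poly a ^^ n) z)\<^sup>2 + a)"
    by (simp add: fun_eq_iff quad_poly_def)
  with Suc show ?case by (auto intro!: holomorphic_intros)
qed

text \<open>The orbits of \<open>z\<close> and of its image differ at most by the point
  \<open>z\<close>, so one is bounded iff the other is.\<close>

lemma quad_poly_mem_filled_julia_iff: "quad_poly a z \<in> filled_julia a \<longleftrightarrow> z \<in> filled_julia a"
proof -
  have "range (\<lambda>n. (quad_poly a ^^ n) z) = insert z (range (\<lambda>n. (quad_poly a ^^ n) (quad_poly a z)))"
    (is "?A = ?B")
  proof
    show "?A \<subseteq> ?B"
    proof clarify
      fix n assume "(quad_poly a ^^ n) z \<notin> range (\<lambda>n. (quad_poly a ^^ n) (quad_poly a z))"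
      then show "(quad_poly a ^^ n) z = z"
        by (cases n) (auto simp: funpow_Suc_right simp del: funpow.simps(2))
    qed
    show "?B \<subseteq> ?A"
    proof -
      have "z = (quad_poly a ^^ 0) z" by simp
      moreover have "(quad_poly a ^^ n) (quad_poly a z) = (quad_poly a ^^ Suc n) z" for n
        by (simp add: funpow_Suc_right del: funpow.simps(2))
      ultimately show ?thesis by blast
    qed
  qed
  then show ?thesis by (simp add: filled_julia_def)
qed

lemma open_quad_poly_image:
  fixes a :: complex
  assumes "open U"
  shows "open (quad_poly a ` U)"
proof (rule open_mapping_thm[OF _ open_UNIV connected_UNIV assms subset_UNIV])
  show "quad_poly a holomorphic_on UNIV"
    using holomorphic_on_quad_poly_funpow[of 1 a UNIV] by simp
  have "quad_poly a 0 \<noteq> quad_poly a 1"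
    by (simp add: quad_poly_def)
  then show "\<not> quad_poly a constant_on UNIV"
    by (metis constant_on_def UNIV_I)
qed

lemma quad_poly_interior_subset:
  fixes a :: complex
  assumes "quad_poly a ` S \<subseteq> S"
  shows "quad_poly a ` interior S \<subseteq> interior S"
  using assms interior_subset[of S] by (intro interior_maximal open_quad_poly_image) auto

text \<open>Off the boundary, a point is interior to the filled-in Julia set or to its complement.
  Both sets are mapped into themselves, and so are their interiors because the map is open; hence a
  point outside \<open>julia a\<close> has its image outside.\<close>

lemma julia_backward_invariant:
  assumes "quad_poly a z \<in> julia a"
  shows "z \<in> julia a"
proof -
  have eq: "julia a = - (interior (filled_julia a) \<union> interior (- filled_julia a))"
    unfolding julia_def frontier_def by (auto simp: closure_interior)
  have "quad_poly a ` interior (filled_julia a) \<subseteq> interior (filled_julia a)"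
    "quad_poly a ` interior (- filled_julia a) \<subseteq> interior (- filled_julia a)"
    by (intro quad_poly_interior_subset; auto simp: quad_poly_mem_filled_julia_iff)+
  with assms show ?thesis unfolding eq by blast
qed

lemma julia_funpow_backward_invariant:
  assumes "(quad_poly a ^^ n) z \<in> julia a"
  shows "z \<in> julia a"
  using assms
  by (induction n arbitrary: z) (auto intro: julia_backward_invariant simp: funpow_swap1)

text \<open>Squaring keeps the unit disc bounded, so 0 is an interior point of the filled-in set.
  This rules out the fixed point 0 below.\<close>

lemma zero_notin_julia_0: "0 \<notin> julia 0"
proof -
  have "ball 0 1 \<subseteq> filled_julia 0"
  proof
    fix z :: complex assume z: "z \<in> ball 0 1"
    have "norm ((quad_poly 0 ^^ n) z) \<le> 1" for n
    proof (induction n)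
      case (Suc n)
      then show ?case by (simp add: quad_poly_def norm_power power_le_one)
    qed (use z in simp)
    then show "z \<in> filled_julia 0"
      by (auto simp: filled_julia_def bounded_iff)
  qed
  then have "0 \<in> interior (filled_julia 0)"
    by (meson centre_in_ball interior_maximal open_ball subsetD zero_less_one)
  then show ?thesis by (simp add: julia_def frontier_def)
qed

section \<open>Density of backward orbits\<close>

text \<open>Schottky's theorem carried by affine maps from the unit disc and the omitted values 0, 1
  to any disc and any two omitted values. \<open>M\<close> is obtained before \<open>f\<close>, so a
  single bound serves all iterates at once.\<close>

lemma Schottky_disc:
  fixes p u v :: complex and r R :: real
  assumes "r > 0" "u \<noteq> v"
  obtains M where
    "\<And>f z. \<lbrakk>f holomorphic_on cball p r; norm (f p) \<le> R; u \<notin> f ` cball p r; v \<notin> f ` cball p r;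
      z \<in> cball p (r/2)\<rbrakk> \<Longrightarrow> norm (f z) \<le> M"
proof
  \<comment> \<open>Schottky's bound on the disc of radius 1/2, with
    \<open>(R + norm u) / norm (v - u)\<close> as the bound on the normalised function at 0.\<close>
  let ?B = "exp (pi * exp (pi * (2 + 2 * ((R + norm u) / norm (v - u)) + 12 * (1/2) / (1 - 1/2))))"
  fix f z
  assume f: "f holomorphic_on cball p r" "norm (f p) \<le> R" "u \<notin> f ` cball p r" "v \<notin> f ` cball p r"
    and z: "z \<in> cball p (r/2)"
  define g where "g = (\<lambda>x. (f (p + of_real r * x) - u) / (v - u))"
  have in_disc: "p + of_real r * x \<in> cball p r" if "x \<in> cball 0 1" for x :: complex
    using that \<open>r > 0\<close> by (simp add: dist_norm norm_mult)
  have "(f \<circ> (\<lambda>x. p + of_real r * x)) holomorphic_on cball 0 1"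
    using in_disc by (intro holomorphic_on_compose_gen[OF _ f(1)] holomorphic_intros) auto
  then have "g holomorphic_on cball 0 1"
    using \<open>u \<noteq> v\<close> by (auto simp: g_def o_def intro!: holomorphic_intros)
  moreover have "norm (g 0) \<le> (R + norm u) / norm (v - u)"
    using f(2) norm_triangle_ineq4[of "f p" u]
    by (simp add: g_def norm_divide divide_right_mono)
  moreover have "\<not> (g x = 0 \<or> g x = 1)" if "x \<in> cball 0 1" for x
    using in_disc[OF that] f(3,4) \<open>u \<noteq> v\<close> by (auto simp: g_def)
  moreover have "norm ((z - p) / of_real r) \<le> 1/2"
    using z \<open>r > 0\<close> by (simp add: dist_norm norm_minus_commute norm_divide field_simps)
  ultimately have "norm (g ((z - p) / of_real r)) \<le> ?B"
    by (intro Schottky) auto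
  moreover have "f z = u + (v - u) * g ((z - p) / of_real r)"
    using \<open>r > 0\<close> \<open>u \<noteq> v\<close> by (simp add: g_def)
  ultimately show "norm (f z) \<le> norm u + norm (v - u) * ?B"
    by (metis norm_triangle_le norm_mult add_left_mono mult_left_mono norm_ge_zero)
qed

lemma julia_subset_closure_backward_orbit:
  assumes fixed: "quad_poly a u = u" and u: "u \<in> julia a"
  shows "julia a \<subseteq> closure (\<Union>n. (quad_poly a ^^ n) -` {u})"
proof
  fix z assume z: "z \<in> julia a"
  \<comment> \<open>If 0 is a fixed point then \<open>a = 0\<close>, the excluded case.\<close>
  have "u \<noteq> 0"
    using fixed u zero_notin_julia_0 by (auto simp: quad_poly_def)
  then have "u \<noteq> - u" by simp
  show "z \<in> closure (\<Union>n. (quad_poly a ^^ n) -` {u})"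
  proof (rule ccontr)
    assume "\<not> ?thesis"
    then obtain e where "e > 0" and e: "\<And>n x. dist x z < e \<Longrightarrow> (quad_poly a ^^ n) x \<noteq> u"
      by (auto simp: closure_approachable)
    \<comment> \<open>An iterate that reached \<open>- u\<close> would reach \<open>u\<close> one
      step later, since the map is even.\<close>
    have e': "(quad_poly a ^^ n) x \<noteq> - u" if "dist x z < e" for n x
      using e[OF that, of "Suc n"] fixed by (auto simp: quad_poly_def)
    \<comment> \<open>With \<open>p\<close> within \<open>r / 2\<close> of \<open>z\<close>, the
      disc \<open>cball p r\<close> stays within \<open>3 * e / 4\<close> of \<open>z\<close>, and
      \<open>z\<close> lies in the smaller disc on which Schottky's bound holds.\<close>
    define r where "r = e / 2"
    have "r > 0" using \<open>e > 0\<close> by (simp add: r_def)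
    then obtain p where p: "p \<in> filled_julia a" "dist z p < r / 2"
      using z unfolding julia_def frontier_straddle by (meson half_gt_zero)
    obtain R where R: "\<And>n. norm ((quad_poly a ^^ n) p) \<le> R"
      using p(1) by (auto simp: filled_julia_def bounded_iff)
    obtain M where M: "\<And>f x. \<lbrakk>f holomorphic_on cball p r; norm (f p) \<le> R; u \<notin> f ` cball p r;
        - u \<notin> f ` cball p r; x \<in> cball p (r/2)\<rbrakk> \<Longrightarrow> norm (f x) \<le> M"
      using Schottky_disc[OF \<open>r > 0\<close> \<open>u \<noteq> - u\<close>, of p R] by blast
    have near: "dist x z < e" if "x \<in> cball p r" for x
      using that p(2) dist_triangle[of x z p] \<open>e > 0\<close> by (simp add: r_def dist_commute)
    have "norm ((quad_poly a ^^ n) x) \<le> M" if "x \<in> cball p (r/2)" for n x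
    proof (rule M[OF holomorphic_on_quad_poly_funpow R _ _ that])
      show "u \<notin> (quad_poly a ^^ n) ` cball p r" "- u \<notin> (quad_poly a ^^ n) ` cball p r"
        using e e' near by fastforce+
    qed
    then have "ball p (r/2) \<subseteq> filled_julia a"
      unfolding filled_julia_def bounded_iff by (force intro: exI[of _ M])
    then have "ball p (r/2) \<subseteq> interior (filled_julia a)"
      by (simp add: interior_maximal)
    moreover have "z \<in> ball p (r/2)"
      using p(2) by (simp add: dist_commute)
    ultimately show False
      using z by (auto simp: julia_def frontier_def)
  qed
qed

section \<open>Idempotent components\<close>

definition idem :: "complex \<Rightarrow> complex \<Rightarrow> bicomplex" where
  "idem x y = bc_of_complex x * bc_e1 + bc_of_complex y * bc_e2"

lemma idem_eq_BC: "idem x y = BC ((x + y) / 2) (\<i> * (x - y) / 2)"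
  by (simp add: idem_def bc_of_complex_def bc_e1_def bc_e2_def bc_j_def bc_i1_def bc_i2_def
      one_bicomplex_def plus_bicomplex_def minus_bicomplex_def times_bicomplex_def
      scaleR_bicomplex_def scaleR_conv_of_real field_simps)

lemma idem_prod_eq: "X \<times>\<^sub>e Y = {idem x y |x y. x \<in> X \<and> y \<in> Y}"
  by (simp add: idem_prod_def idem_def)

lemma idem_components:
  "bc1 (idem x y) - bc2 (idem x y) * \<i> = x" "bc1 (idem x y) + bc2 (idem x y) * \<i> = y"
  by (simp_all add: idem_eq_BC field_simps)

lemma idem_eq_iff: "idem x y = idem x' y' \<longleftrightarrow> x = x' \<and> y = y'"
  by (metis idem_components)

lemma bicomplex_eq_idem: "w = idem (bc1 w - bc2 w * \<i>) (bc1 w + bc2 w * \<i>)"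
  using bc_idempotent_representation[of "bc1 w" "bc2 w"] BC_eq[of "bc1 w" "bc2 w"]
  by (simp add: idem_def)

lemma quad_poly_idem: "quad_poly (idem a b) (idem x y) = idem (quad_poly a x) (quad_poly b y)"
  by (simp add: quad_poly_def idem_eq_BC power2_eq_square times_bicomplex_def plus_bicomplex_def
      field_simps)

lemma quad_poly_funpow_idem:
  "(quad_poly (idem a b) ^^ n) (idem x y) = idem ((quad_poly a ^^ n) x) ((quad_poly b ^^ n) y)"
  by (induction n) (simp_all add: quad_poly_idem)

text \<open>Splitting the difference into its two idempotent parts suffices: \<open>idem x 0\<close>
  and \<open>idem 0 x\<close> both have norm \<open>norm x / sqrt 2\<close>.\<close>

lemma dist_idem_le: "dist (idem x y) (idem x' y') \<le> dist x x' + dist y y'"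
proof -
  have half: "sqrt ((norm z / 2)\<^sup>2 + (norm z / 2)\<^sup>2) \<le> norm z" for z :: complex
    using sqrt_sum_squares_le_sum[of "norm z / 2" "norm z / 2"] by simp
  have "norm (idem x 0) \<le> norm x" "norm (idem 0 y) \<le> norm y" for x y
    using half by (simp_all add: idem_eq_BC norm_bicomplex_def norm_divide norm_mult)
  moreover have "idem x y - idem x' y' = idem (x - x') 0 + idem 0 (y - y')"
    by (simp add: idem_eq_BC plus_bicomplex_def minus_bicomplex_def field_simps)
  ultimately show ?thesis
    by (metis dist_norm norm_triangle_mono)
qed

theorem theorem7:
  fixes c1 c2 :: complex and c w1 :: bicomplex
  assumes "c = bc_of_complex c1 + bc_of_complex c2 * bc_i2"
    and "quad_poly c w1 = w1"
    and "w1 \<in> julia (c1 - c2 * \<i>) \<times>\<^sub>e julia (c1 + c2 * \<i>)"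
  shows "dense_in (\<Union>k\<in>{1..}. (quad_poly c ^^ k) -` {w1})
           (julia (c1 - c2 * \<i>) \<times>\<^sub>e julia (c1 + c2 * \<i>))"
proof -
  define a b where "a = c1 - c2 * \<i>" and "b = c1 + c2 * \<i>"
  have c: "c = idem a b"
    using assms(1) bc_idempotent_representation[of c1 c2] by (simp add: a_def b_def idem_def)
  obtain u v where w1: "w1 = idem u v" and u: "u \<in> julia a" and v: "v \<in> julia b"
    using assms(3) by (auto simp: idem_prod_eq a_def b_def)
  have fix_u: "quad_poly a u = u" and fix_v: "quad_poly b v = v"
    using assms(2) by (simp_all add: c w1 quad_poly_idem idem_eq_iff)
  have mem: "(quad_poly c ^^ k) (idem x y) = w1 \<longleftrightarrow>
      (quad_poly a ^^ k) x = u \<and> (quad_poly b ^^ k) y = v" for k x y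
    by (simp add: c w1 quad_poly_funpow_idem idem_eq_iff)
  show ?thesis
    unfolding dense_in_def a_def[symmetric] b_def[symmetric]
  proof
    show "(\<Union>k\<in>{1..}. (quad_poly c ^^ k) -` {w1}) \<subseteq> julia a \<times>\<^sub>e julia b"
    proof
      fix w assume "w \<in> (\<Union>k\<in>{1..}. (quad_poly c ^^ k) -` {w1})"
      moreover obtain x y where w: "w = idem x y"
        using bicomplex_eq_idem by blast
      ultimately obtain k where "(quad_poly a ^^ k) x = u" "(quad_poly b ^^ k) y = v"
        by (auto simp: mem)
      then have "x \<in> julia a" "y \<in> julia b"
        using u v julia_funpow_backward_invariant by blast+
      then show "w \<in> julia a \<times>\<^sub>e julia b"
        by (auto simp: w idem_prod_eq)
    qed
    show "julia a \<times>\<^sub>e julia b \<subseteq> closure (\<Union>k\<in>{1..}. (quad_poly c ^^ k) -` {w1})"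
    proof
      fix w assume "w \<in> julia a \<times>\<^sub>e julia b"
      then obtain x y where w: "w = idem x y" and "x \<in> julia a" "y \<in> julia b"
        by (auto simp: idem_prod_eq)
      then have x: "x \<in> closure (\<Union>n. (quad_poly a ^^ n) -` {u})"
        and y: "y \<in> closure (\<Union>n. (quad_poly b ^^ n) -` {v})"
        using julia_subset_closure_backward_orbit fix_u fix_v u v by blast+
      show "w \<in> closure (\<Union>k\<in>{1..}. (quad_poly c ^^ k) -` {w1})"
        unfolding closure_approachable
      proof (intro allI impI)
        fix e :: real assume "e > 0"
        then have "e / 2 > 0" by simp
        obtain m x' where x': "(quad_poly a ^^ m) x' = u" "dist x' x < e / 2"
          using x \<open>e / 2 > 0\<close> unfolding closure_approachable by fastforce
        obtain n y' where y': "(quad_poly b ^^ n) y' = v" "dist y' y < e / 2"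
          using y \<open>e / 2 > 0\<close> unfolding closure_approachable by fastforce
        \<comment> \<open>Both components must hit their targets at the same time; further iterates
          do no harm, as \<open>u\<close> and \<open>v\<close> are fixed. The \<open>Suc\<close>
          ensures \<open>k \<ge> 1\<close> even when \<open>m = n = 0\<close>.\<close>
        define k where "k = Suc (n + m)"
        have "k = Suc n + m" "k = Suc m + n"
          by (simp_all add: k_def)
        then have "(quad_poly a ^^ k) x' = (quad_poly a ^^ Suc n) ((quad_poly a ^^ m) x')"
          "(quad_poly b ^^ k) y' = (quad_poly b ^^ Suc m) ((quad_poly b ^^ n) y')"
          by (metis comp_apply funpow_add)+
        then have "(quad_poly a ^^ k) x' = u" "(quad_poly b ^^ k) y' = v"
          using x'(1) y'(1) funpow_fixpoint[of "quad_poly a", OF fix_u]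
            funpow_fixpoint[of "quad_poly b", OF fix_v] by metis+
        then have "idem x' y' \<in> (\<Union>k\<in>{1..}. (quad_poly c ^^ k) -` {w1})"
          using mem[of k x' y'] by (intro UN_I[of k]) (auto simp: k_def)
        moreover have "dist (idem x' y') w < e"
          using dist_idem_le[of x' y' x y] x'(2) y'(2) by (simp add: w)
        ultimately show "\<exists>w'\<in>\<Union>k\<in>{1..}. (quad_poly c ^^ k) -` {w1}. dist w' w < e" ..
      qed
    qed
  qed
qed

end
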